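(* The recursion $x_{n+1}=Q(x_n)$ on $\mathbb{N}_0$ has cycles of type $C_m$ of all possible lengths (that is, for every positive integer $m$, $C_m$ is a cycle of length $m$ of the recursion). Every orbit of the recursion either reaches such a cycle (that is, $x_n\in C_m$ for some $n\ge 0$ and some positive integer $m$) or it is unbounded.
   Context: Let $\mathbb{N}_0=\{0,1,2,\ldots\}$. The map $Q:\mathbb{N}_0\to\mathbb{N}_0$ is defined by $Q(n)=n/2$ if $n$ is even and $Q(n)=\binom{n}{2}=\frac{n(n-1)}{2}$ if $n$ is odd. For $x_0\in\mathbb{N}_0$, the orbit of $x_0$ is the sequence $(x_n)_{n\ge 0}$ with $x_{n+1}=Q(x_n)$. If $x_m=x_0$ for some positive integer $m$, then the numbers $x_0,x_1,\ldots,x_{m-1}$ repeat, and they are called an $m$-cycle (a cycle of length $m$). For a positive integer $m$, $C_m$ denotes the cycle given by the numbers, in the order shown, $$2^{m}+1\rightarrow 2^{m-1}(2^{m}+1)\rightarrow 2^{m-2}(2^{m}+1)\rightarrow\cdots\rightarrow 2(2^{m}+1)\rightarrow 2^{m}+1,$$ i.e. $C_m=\{2^{i}(2^m+1): 0\le i\le m-1\}$.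
   Formalization: The claim that every orbit reaches some C_m or is unbounded is stated only for starting values other than 0 and the powers of two; those orbits descend to the fixed point 0, so they are bounded and reach no C_m. *)

theory Defs
  imports Complex_Main
begin

definition Q :: "nat \<Rightarrow> nat" where
  "Q n = (if even n then n div 2 else n choose 2)"

definition orbit :: "nat \<Rightarrow> nat \<Rightarrow> nat" where
  "orbit x0 n = (Q ^^ n) x0"

text \<open>A cycle is a list because the order of its elements matters. Distinctness makes
  \<open>m\<close> its exact length, rather than a multiple of the least period.\<close>

definition is_cycle :: "nat \<Rightarrow> nat list \<Rightarrow> bool" where
  "is_cycle m xs \<longleftrightarrow>
     0 < m \<and> distinct xs \<and> (\<exists>x0. orbit x0 m = x0 \<and> xs = map (orbit x0) [0..<m])"

definition C :: "nat \<Rightarrow> nat list" where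
  "C m = (2 ^ m + 1) # map (\<lambda>i. 2 ^ i * (2 ^ m + 1)) (rev [1..<m])"

lemma set_C:
  assumes "0 < m"
  shows "set (C m) = {2 ^ i * (2 ^ m + 1) | i. i \<le> m - 1}"
proof -
  have "{i. i \<le> m - 1} = insert 0 {1..<m}"
    using assms by auto
  moreover have "{2 ^ i * (2 ^ m + 1) | i. i \<le> m - 1} = (\<lambda>i. 2 ^ i * (2 ^ m + 1 :: nat)) ` {i. i \<le> m - 1}"
    by blast
  ultimately show ?thesis
    by (simp add: C_def)
qed

definition reaches_C :: "nat \<Rightarrow> bool" where
  "reaches_C x0 \<longleftrightarrow> (\<exists>n m. 0 < m \<and> orbit x0 n \<in> set (C m))"

definition unbounded_orbit :: "nat \<Rightarrow> bool" where
  "unbounded_orbit x0 \<longleftrightarrow> \<not> bdd_above (range (orbit x0))"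

text \<open>Since \<open>Q 1 = 0\<close> and \<open>Q 0 = 0\<close>, the orbits of \<open>0\<close> and of the powers of two descend to the
  fixed point \<open>0\<close>. They are bounded and meet no \<open>C m\<close>, so the dichotomy between
  \<open>reaches_C\<close> and \<open>unbounded_orbit\<close> fails for these starting values.\<close>

lemma orbit_0: "orbit 0 n = 0"
  by (induction n) (simp_all add: orbit_def Q_def)

lemma orbit_pow2: "orbit (2 ^ k) n = 0 \<or> (\<exists>j\<le>k. orbit (2 ^ k) n = 2 ^ j)"
proof (induction n)
  case 0
  show ?case by (auto simp: orbit_def)
next
  case (Suc n)
  have step: "orbit (2 ^ k) (Suc n) = Q (orbit (2 ^ k) n)"
    by (simp add: orbit_def)
  from Suc show ?case
  proof (elim disjE exE conjE)
    assume "orbit (2 ^ k) n = 0"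
    then show ?thesis by (simp add: step Q_def)
  next
    fix j assume "j \<le> k" "orbit (2 ^ k) n = 2 ^ j"
    then show ?thesis
      by (cases j) (auto simp: step Q_def intro: exI[of _ "j - 1"])
  qed
qed

lemma exceptional_orbits:
  assumes "x0 = 0 \<or> (\<exists>k. x0 = 2 ^ k)"
  shows "\<not> reaches_C x0" and "\<not> unbounded_orbit x0"
proof -
  have val: "orbit x0 n = 0 \<or> (\<exists>j. orbit x0 n = 2 ^ j)" for n
    using assms orbit_0 orbit_pow2 by metis
  have le: "orbit x0 n \<le> x0" for n
    using assms
  proof (elim disjE exE)
    fix k assume "x0 = 2 ^ k"
    then show ?thesis using orbit_pow2[of k n] by auto
  qed (simp add: orbit_0)
  show "\<not> unbounded_orbit x0"
    using le by (auto simp: unbounded_orbit_def bdd_above_def)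
  show "\<not> reaches_C x0"
  proof
    assume "reaches_C x0"
    then obtain n m i where m: "0 < m" and eq: "orbit x0 n = 2 ^ i * (2 ^ m + 1)"
      by (auto simp: reaches_C_def set_C)
    then obtain j where j: "(2::nat) ^ j = 2 ^ i * (2 ^ m + 1)"
      using val[of n] by auto
    then have "(2 ^ m + 1 :: nat) dvd 2 ^ j" by (metis dvd_triv_right)
    moreover have "coprime (2 ^ m + 1 :: nat) (2 ^ j)"
      using m by simp
    ultimately have "is_unit (2 ^ m + 1 :: nat)"
      using coprime_absorb_left by blast
    then show False by simp
  qed
qed

end

theory Submission
  imports Defs
begin

text \<open>Write an odd number \<open>n > 1\<close> as \<open>n = 2 ^ m * q + 1\<close> with \<open>q\<close> odd and \<open>m > 0\<close>. Then
  \<open>Q n = 2 ^ (m - 1) * (q * n)\<close>, so the next odd number in the orbit is \<open>q * n\<close>. If \<open>q = 1\<close> then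
  \<open>n\<close> is the first element of \<open>C m\<close>; otherwise the odd number has strictly increased. Hence the
  odd members of an orbit that never reaches a cycle \<open>C m\<close> grow beyond all bounds.\<close>

lemma orbit_add: "orbit x (a + b) = orbit (orbit x a) b"
  by (simp add: orbit_def funpow_add add.commute[of a])

lemma orbit_Suc: "orbit x (Suc n) = orbit (Q x) n"
  by (simp add: orbit_def funpow_swap1)

lemma orbit_power2_mult: "j \<le> k \<Longrightarrow> orbit (2 ^ k * q) j = 2 ^ (k - j) * q"
proof (induction j arbitrary: k)
  case 0
  then show ?case by (simp add: orbit_def)
next
  case (Suc j)
  then obtain k' where "k = Suc k'" by (cases k) auto
  with Suc show ?case by (simp add: orbit_Suc Q_def mult.assoc)
qed

text \<open>The exponent \<open>Suc k\<close> makes \<open>n\<close> odd, so \<open>Q n\<close> is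
  \<open>n * (n - 1) / 2\<close>, and the division by 2 lowers the exponent to
  \<open>k\<close>.\<close>

lemma Q_odd:
  assumes "n = 2 ^ Suc k * q + 1"
  shows "Q n = 2 ^ k * (q * n)"
  using assms by (simp add: Q_def choose_two algebra_simps)

lemma power2_odd_decomposition:
  assumes "(x::nat) \<noteq> 0"
  obtains k q where "odd q" "x = 2 ^ k * q"
proof -
  have "\<exists>k q. odd q \<and> x = 2 ^ k * q"
    using assms
  proof (induction x rule: less_induct)
    case (less x)
    show ?case
    proof (cases "even x")
      case True
      with less.prems have "x div 2 < x" "x div 2 \<noteq> 0" by auto
      with less.IH obtain k q where "odd q" "x div 2 = 2 ^ k * q" by blast
      with True have "x = 2 ^ Suc k * q" by auto
      with \<open>odd q\<close> show ?thesis by blast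
    next
      case False
      then show ?thesis by (intro exI[of _ 0] exI[of _ x]) simp
    qed
  qed
  with that show thesis by blast
qed

text \<open>The case \<open>q = 1\<close> of \<open>Q_odd\<close> gives the first step; the other
  \<open>j - 1\<close> steps are halvings. At \<open>j = 0\<close> the formula would be off by a
  factor \<open>2 ^ m\<close>.\<close>

lemma orbit_first_C:
  assumes "0 < j" "j \<le> m"
  shows "orbit (2 ^ m + 1) j = 2 ^ (m - j) * (2 ^ m + 1)"
proof -
  obtain m' j' where "m = Suc m'" "j = Suc j'"
    using assms by (metis Suc_le_D less_imp_Suc_add add_0)
  with assms show ?thesis
    using Q_odd[of "2 ^ m + 1" m' 1] orbit_power2_mult[of j' m' "2 ^ m + 1"]
    by (simp add: orbit_Suc)
qed

lemma distinct_C: "distinct (C m)"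
proof -
  have "inj_on (\<lambda>i. 2 ^ i * (2 ^ m + 1 :: nat)) A" for A
    by (rule inj_onI) (simp del: mult_Suc_right add: mult_cancel2)
  \<comment> \<open>The head is the term with exponent 0, so the whole list is one injective map
    over distinct exponents.\<close>
  moreover have "C m = map (\<lambda>i. 2 ^ i * (2 ^ m + 1)) (0 # rev [1..<m])"
    by (simp add: C_def)
  ultimately show ?thesis
    by (simp only: distinct_map) simp
qed

lemma C_eq_map_orbit:
  assumes "0 < m"
  shows "C m = map (orbit (2 ^ m + 1)) [0..<m]"
proof (rule nth_equalityI)
  show "length (C m) = length (map (orbit (2 ^ m + 1)) [0..<m])"
    using assms by (simp add: C_def)
next
  fix i assume "i < length (C m)"
  with assms have "i < m" by (simp add: C_def)
  show "C m ! i = map (orbit (2 ^ m + 1)) [0..<m] ! i"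
  proof (cases i)
    case 0
    with assms show ?thesis by (simp add: C_def orbit_def)
  next
    case (Suc j)
    \<comment> \<open>The reversed list counts down from \<open>m - 1\<close>, and
      \<open>m - 1 - j = m - i\<close>.\<close>
    with \<open>i < m\<close> have "rev [1..<m] ! j = m - i"
      by (subst rev_nth) auto
    moreover from Suc have "C m ! i = map (\<lambda>i. 2 ^ i * (2 ^ m + 1)) (rev [1..<m]) ! j"
      by (simp only: C_def nth_Cons_Suc)
    then have "C m ! i = 2 ^ (rev [1..<m] ! j) * (2 ^ m + 1)"
      using Suc \<open>i < m\<close> by (subst (asm) nth_map) auto
    ultimately have "C m ! i = 2 ^ (m - i) * (2 ^ m + 1)"
      by (simp only:)
    with Suc \<open>i < m\<close> show ?thesis
      using orbit_first_C[of i m] by simp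
  qed
qed

lemma is_cycle_C:
  assumes "0 < m"
  shows "is_cycle m (C m)"
  unfolding is_cycle_def
proof (intro conjI exI)
  show "orbit (2 ^ m + 1) m = 2 ^ m + 1"
    using orbit_first_C[of m m] assms by simp
qed (use assms distinct_C C_eq_map_orbit[OF assms] in blast)+

text \<open>One binomial step and the halvings after it lead from \<open>n\<close> to
  \<open>q * n\<close>; the third assumption excludes \<open>q = 1\<close>.\<close>

lemma odd_orbit_increases:
  assumes "odd n" "1 < n" "\<nexists>m. 0 < m \<and> n = 2 ^ m + 1"
  obtains t where "odd (orbit n t)" "n < orbit n t"
proof -
  obtain m q where q: "odd q" "n - 1 = 2 ^ m * q"
    using power2_odd_decomposition[of "n - 1"] assms(2) by (metis zero_less_diff less_irrefl)
  then have n: "n = 2 ^ m * q + 1" using assms by simp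
  \<comment> \<open>For \<open>m = 0\<close>, \<open>n = q + 1\<close> would be even.\<close>
  with assms(1) q(1) obtain k where k: "m = Suc k" by (cases m) auto
  with n assms(3) have "q \<noteq> 1" by auto
  with q(1) have "1 < q" by (cases q) auto
  have "orbit n (Suc k) = q * n"
    using Q_odd[of n k q] n k by (simp add: orbit_Suc orbit_power2_mult)
  with that[of "Suc k"] assms q(1) \<open>1 < q\<close> show thesis by simp
qed

lemma reaches_C_or_unbounded:
  assumes "x0 \<noteq> 0" "\<nexists>k. x0 = 2 ^ k"
  shows "reaches_C x0 \<or> unbounded_orbit x0"
proof (cases "reaches_C x0")
  case nr: False
  \<comment> \<open>The bound \<open>N + 1\<close> keeps the odd term above 1, the odd value that
    drops to 0.\<close>
  have "\<exists>t. odd (orbit x0 t) \<and> N + 1 < orbit x0 t" for N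
  proof (induction N)
    case 0
    obtain k q where q: "odd q" "x0 = 2 ^ k * q"
      using power2_odd_decomposition assms(1) by blast
    with assms(2) have "q \<noteq> 1" by auto
    with q(1) have "1 < q" by (cases q) auto
    with q show ?case
      using orbit_power2_mult[of k k q] by (intro exI[of _ k]) simp
  next
    case (Suc N)
    then obtain t where t: "odd (orbit x0 t)" "N + 1 < orbit x0 t" by blast
    \<comment> \<open>Such a number is the head of \<open>C m\<close>, so the orbit would have
      reached a cycle.\<close>
    have "\<nexists>m. 0 < m \<and> orbit x0 t = 2 ^ m + 1"
      using nr unfolding reaches_C_def C_def by (metis list.set_intros(1))
    with t obtain s where s: "odd (orbit (orbit x0 t) s)" "orbit x0 t < orbit (orbit x0 t) s"
      using odd_orbit_increases[of "orbit x0 t"] by auto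
    with t show ?case
      by (intro exI[of _ "t + s"]) (simp add: orbit_add)
  qed
  then have "unbounded_orbit x0"
    unfolding unbounded_orbit_def bdd_above_def
    by (metis add_lessD1 not_less rangeI)
  then show ?thesis ..
qed simp

theorem theorem2:
  "(\<forall>m>0. is_cycle m (C m)) \<and>
   (\<forall>x0. x0 \<noteq> 0 \<and> (\<nexists>k. x0 = 2 ^ k) \<longrightarrow> reaches_C x0 \<or> unbounded_orbit x0)"
  using is_cycle_C reaches_C_or_unbounded by blast

end
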